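(* Let $A:\mathbb{Z}\to\mathrm{SL}(2,\mathbb{R})$ be a map for which there is $M>0$ with $\|A(j)\|\le M$ for all $j\in\mathbb{Z}$. Then $A$ is uniformly hyperbolic if and only if there exist $c>0$ and $\lambda>1$ such that $$\|A_n(j)\|\ge c\lambda^{n}\quad\text{for all integers } n\ge 1 \text{ and all } j\in\mathbb{Z}.$$
   Context: For $A:\mathbb{Z}\to\mathrm{SL}(2,\mathbb{R})$ and $j\in\mathbb{Z}$ set $A_n(j)=A(j+n-1)\cdots A(j)$ for $n\ge1$, $A_0(j)=I_2$, and $A_n(j)=A(j+n)^{-1}\cdots A(j-1)^{-1}$ for $n\le-1$. $\|\cdot\|$ is the Euclidean norm on $\mathbb{R}^2$ and the operator norm on matrices. $\mathbb{RP}^1=\mathbb{R}/(\pi\mathbb{Z})$ is the set of lines through the origin of $\mathbb{R}^2$ (a line is identified with its angle to the positive horizontal axis), and $B\cdot\theta$ is the induced action of $B\in\mathrm{SL}(2,\mathbb{R})$ on $\theta\in\mathbb{RP}^1$; $\vec v\in\theta$ means that $\vec v$ lies on the line $\theta$. $A$ is called uniformly hyperbolic if there are maps $u,s:\mathbb{Z}\to\mathbb{RP}^1$ such that (1) $A(j)\cdot u(j)=u(j+1)$ and $A(j)\cdot s(j)=s(j+1)$ for all $j\in\mathbb{Z}$; (2) there exist $C>0$, $\lambda>1$ such that $\|A_{-n}(j)\vec v\|\le C\lambda^{-n}$ and $\|A_n(j)\vec w\|\le C\lambda^{-n}$ for all $n\ge1$, all $j\in\mathbb{Z}$ and all unit vectors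 $\vec v\in u(j)$, $\vec w\in s(j)$. *)

theory Defs
  imports "HOL-Analysis.Analysis"
begin

definition SL2 :: "(real^2^2) set" where
  "SL2 = {B. det B = 1}"

(* The library norm on real^2^2 is the Frobenius norm, so the operator norm
   has to be taken of the associated linear map. *)
definition opnorm :: "real^2^2 \<Rightarrow> real" where
  "opnorm B = onorm (\<lambda>x. B *v x)"

(* A point of the projective line is the line itself, as a set of vectors, so
   that "v lies on the line" is set membership; the angle of a line is not used. *)
definition RP1 :: "(real^2) set set" where
  "RP1 = {L. subspace L \<and> dim L = 1}"

definition act :: "real^2^2 \<Rightarrow> (real^2) set \<Rightarrow> (real^2) set" where
  "act B L = (\<lambda>x. B *v x) ` L"

(* A(j+n-1) ... A(j) *)
primrec forward :: "(int \<Rightarrow> real^2^2) \<Rightarrow> nat \<Rightarrow> int \<Rightarrow> real^2^2" where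
  "forward A 0 j = mat 1"
| "forward A (Suc n) j = A (j + int n) ** forward A n j"

(* A(j-n)^(-1) ... A(j-1)^(-1) *)
primrec backward :: "(int \<Rightarrow> real^2^2) \<Rightarrow> nat \<Rightarrow> int \<Rightarrow> real^2^2" where
  "backward A 0 j = mat 1"
| "backward A (Suc n) j = matrix_inv (A (j - int (Suc n))) ** backward A n j"

definition iterate :: "(int \<Rightarrow> real^2^2) \<Rightarrow> int \<Rightarrow> int \<Rightarrow> real^2^2" where
  "iterate A n j = (if n \<ge> 0 then forward A (nat n) j else backward A (nat (- n)) j)"

definition uniformly_hyperbolic :: "(int \<Rightarrow> real^2^2) \<Rightarrow> bool" where
  "uniformly_hyperbolic A \<longleftrightarrow>
    (\<exists>u s :: int \<Rightarrow> (real^2) set.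
      (\<forall>j. u j \<in> RP1 \<and> s j \<in> RP1) \<and>
      (\<forall>j. act (A j) (u j) = u (j + 1) \<and> act (A j) (s j) = s (j + 1)) \<and>
      (\<exists>C>0. \<exists>l>1. \<forall>n::int. n \<ge> 1 \<longrightarrow> (\<forall>j v w.
        v \<in> u j \<and> norm v = 1 \<and> w \<in> s j \<and> norm w = 1 \<longrightarrow>
          norm (iterate A (- n) j *v v) \<le> C * l powi (- n) \<and>
          norm (iterate A n j *v w) \<le> C * l powi (- n))))"

end

theory Submission
  imports Defs
begin

text \<open>Let \<open>a\<^sub>n = \<parallel>A\<^sub>n(j)\<parallel>\<close>. Area preservation shows that the most contracted directions of
  \<open>A\<^sub>n(j)\<close> and \<open>A\<^sub>n\<^sub>+\<^sub>1(j)\<close> differ by at most \<open>2M\<^sup>2/a\<^sub>n\<^sup>2\<close>, so exponential growth makes them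
  converge to a line \<open>s(j)\<close>, and these lines are invariant. On \<open>s(j)\<close> the matrix \<open>A\<^sub>n(j)\<close> has norm at most
  \<open>1/a\<^sub>n + 2M\<^sup>2 a\<^sub>n (\<Sum>k\<ge>n. 1/a\<^sub>k\<^sup>2)\<close>, which may be large if \<open>a\<close> drops after time \<open>n\<close>. If however
  \<open>a\<^sub>k \<ge> a\<^sub>n q\<^sup>k\<^sup>-\<^sup>n\<close> for all \<open>k \<ge> n\<close>, with \<open>q > 1\<close>, it is \<open>O(1/a\<^sub>n)\<close>. For \<open>q = \<surd>\<lambda>\<close> such
  times \<open>n\<close> occur in a window independent of \<open>j\<close>, hence from every \<open>j\<close> the line \<open>s(j)\<close> is contracted by
  \<open>1/2\<close> within a bounded time, and iterating gives exponential decay. The unstable lines are the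
  stable lines of the time-reversed cocycle. The converse is immediate from
  \<open>A\<^sub>n(j)\<^sup>-\<^sup>1 = A\<^sub>-\<^sub>n(j+n)\<close> on the unstable line.\<close>

section \<open>Oriented area as a measure of the angle between lines\<close>

definition cross2 :: "real^2 \<Rightarrow> real^2 \<Rightarrow> real" where
  "cross2 x y = x $ 1 * y $ 2 - x $ 2 * y $ 1"

definition rot90 :: "real^2 \<Rightarrow> real^2" where
  "rot90 x = vector [- x $ 2, x $ 1]"

lemma inner_2: "(x::real^2) \<bullet> y = x $ 1 * y $ 1 + x $ 2 * y $ 2"
  by (simp add: inner_vec_def sum_2)

lemma cross2_rot90: "cross2 x (rot90 y) = x \<bullet> y"
  by (simp add: cross2_def rot90_def inner_2)

lemma norm_rot90 [simp]: "norm (rot90 x) = norm x"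
  by (simp add: norm_eq inner_2 rot90_def)

lemma cross2_swap: "cross2 x y = - cross2 y x"
  by (simp add: cross2_def)

lemma abs_cross2_le: "\<bar>cross2 x y\<bar> \<le> norm x * norm y"
proof -
  have "cross2 x y = x \<bullet> rot90 (- y)"
    by (simp add: cross2_def rot90_def inner_2)
  then show ?thesis
    using Cauchy_Schwarz_ineq2[of x "rot90 (- y)"] by simp
qed

lemma cross2_matrix: "cross2 (B *v x) (B *v y) = det B * cross2 x y"
  by (simp add: cross2_def matrix_vector_mult_def sum_2 det_2 algebra_simps)

text \<open>For unit vectors \<open>|cross2 x y|\<close> is the sine of the angle between their
  lines, a distance that ignores the sign of the vectors. The inequality is the addition formula for
  the sine with both cosines bounded by 1.\<close>

lemma abs_cross2_triangle:
  assumes "norm x = 1" "norm y = 1" "norm z = 1"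
  shows "\<bar>cross2 x z\<bar> \<le> \<bar>cross2 x y\<bar> + \<bar>cross2 y z\<bar>"
proof -
  have "cross2 x z * (y \<bullet> y) = (x \<bullet> y) * cross2 y z + cross2 x y * (y \<bullet> z)"
    by (simp add: cross2_def inner_2 algebra_simps)
  then have "cross2 x z = (x \<bullet> y) * cross2 y z + cross2 x y * (y \<bullet> z)"
    using assms by (simp add: dot_square_norm)
  moreover have "\<bar>(x \<bullet> y) * cross2 y z\<bar> \<le> 1 * \<bar>cross2 y z\<bar>"
    using Cauchy_Schwarz_ineq2[of x y] assms unfolding abs_mult by (intro mult_right_mono) auto
  moreover have "\<bar>cross2 x y * (y \<bullet> z)\<bar> \<le> \<bar>cross2 x y\<bar> * 1"
    using Cauchy_Schwarz_ineq2[of y z] assms unfolding abs_mult by (intro mult_left_mono) auto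
  ultimately show ?thesis by linarith
qed

text \<open>Cramer's rule in the plane, with the denominator cleared so that parallel
  \<open>y\<close> and \<open>w\<close> are allowed.\<close>

lemma cross2_decompose: "cross2 y w *\<^sub>R x = cross2 x w *\<^sub>R y + cross2 y x *\<^sub>R w"
  by (simp add: vec_eq_iff forall_2 cross2_def algebra_simps)

lemma cross2_zero_parallel:
  assumes "cross2 v w = 0" "norm w = 1"
  shows "v = (v \<bullet> w) *\<^sub>R w"
proof -
  have "cross2 w (rot90 w) = 1"
    using assms by (simp add: cross2_rot90 dot_square_norm)
  moreover have "cross2 w v = 0" using assms cross2_swap[of v w] by simp
  ultimately show ?thesis
    using cross2_decompose[of w "rot90 w" v] by (simp add: cross2_rot90)
qed

section \<open>Operator norms of matrices of determinant one\<close>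

lemma opnorm_le: "norm (B *v x) \<le> opnorm B * norm x"
  unfolding opnorm_def by (rule onorm) (rule matrix_vector_mul_bounded_linear)

lemma opnorm_nonneg: "0 \<le> opnorm B"
  unfolding opnorm_def by (rule onorm_pos_le) (rule matrix_vector_mul_bounded_linear)

lemma opnorm_leI: "(\<And>x. norm (B *v x) \<le> b * norm x) \<Longrightarrow> opnorm B \<le> b"
  unfolding opnorm_def by (rule onorm_le)

lemma opnorm_mult_le: "opnorm (B ** C) \<le> opnorm B * opnorm C"
proof (rule opnorm_leI)
  fix x
  have "norm ((B ** C) *v x) \<le> opnorm B * norm (C *v x)"
    using opnorm_le[of B "C *v x"] by (simp add: matrix_vector_mul_assoc)
  also have "\<dots> \<le> opnorm B * (opnorm C * norm x)"
    by (intro mult_left_mono opnorm_le opnorm_nonneg)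
  finally show "norm ((B ** C) *v x) \<le> opnorm B * opnorm C * norm x"
    by (simp add: mult.assoc)
qed

lemma opnorm_attained:
  obtains x where "norm x = 1" "norm (B *v x) = opnorm B"
proof -
  have "axis 1 1 \<in> sphere (0::real^2) 1" by (simp add: norm_axis_1)
  then have "sphere (0::real^2) 1 \<noteq> {}" by blast
  moreover have "continuous_on (sphere 0 1) (\<lambda>x. norm (B *v x))"
    by (intro continuous_intros linear_continuous_on matrix_vector_mul_bounded_linear)
  ultimately obtain x where x: "x \<in> sphere 0 1"
    and max: "\<And>y. y \<in> sphere 0 1 \<Longrightarrow> norm (B *v y) \<le> norm (B *v x)"
    using continuous_attains_sup[of "sphere (0::real^2) 1" "\<lambda>x. norm (B *v x)"] by auto
  have "opnorm B \<le> norm (B *v x)"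
  proof (rule opnorm_leI)
    fix y
    show "norm (B *v y) \<le> norm (B *v x) * norm y"
    proof (cases "y = 0")
      case False
      then show ?thesis
        using max[of "y /\<^sub>R norm y"]
        by (simp add: matrix_vector_mult_scaleR field_simps)
    qed simp
  qed
  moreover have "norm (B *v x) \<le> opnorm B"
    using opnorm_le[of B x] x by simp
  ultimately show thesis using that[of x] x by simp
qed

text \<open>Area preservation, applied to \<open>x\<close> and the vector orthogonal to it.\<close>

lemma norm_le_opnorm_mult_norm_image:
  assumes "det B = 1"
  shows "norm x \<le> opnorm B * norm (B *v x)"
proof (cases "x = 0")
  case False
  have "norm x * norm x = \<bar>cross2 (B *v x) (B *v rot90 x)\<bar>"
    using assms by (simp add: cross2_matrix cross2_rot90 dot_square_norm power2_eq_square)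
  also have "\<dots> \<le> norm (B *v x) * norm (B *v rot90 x)" by (rule abs_cross2_le)
  also have "\<dots> \<le> norm (B *v x) * (opnorm B * norm x)"
    using opnorm_le[of B "rot90 x"] by (intro mult_left_mono) auto
  finally show ?thesis using False by (simp add: mult.commute mult.left_commute)
qed simp

lemma one_le_opnorm:
  assumes "det B = 1"
  shows "1 \<le> opnorm B"
proof -
  obtain x where x: "norm x = 1" "norm (B *v x) = opnorm B" by (rule opnorm_attained)
  have "1 \<le> opnorm B * opnorm B"
    using norm_le_opnorm_mult_norm_image[OF assms, of x] x by simp
  moreover have "opnorm B * opnorm B < 1 * 1" if "opnorm B < 1"
    using that by (intro mult_strict_mono') (auto simp: opnorm_nonneg)
  ultimately show ?thesis by fastforce
qed

text \<open>The area estimate for \<open>C\<close>, taken at \<open>B *v x\<close>, bounds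
  \<open>norm (B *v x)\<close> by \<open>opnorm C * norm x\<close>. This carries norm bounds over to
  the reversed cocycle.\<close>

lemma opnorm_le_opnorm_left_inverse:
  assumes "det C = 1" "C ** B = mat 1"
  shows "opnorm B \<le> opnorm C"
  using norm_le_opnorm_mult_norm_image[OF assms(1), of "B *v _"] assms(2)
  by (intro opnorm_leI) (simp add: matrix_vector_mul_assoc)

lemma opnorm_factor_le:
  assumes "det B = 1"
  shows "opnorm C \<le> opnorm B * opnorm (B ** C)"
proof (rule opnorm_leI)
  fix x
  have "norm (C *v x) \<le> opnorm B * norm ((B ** C) *v x)"
    using norm_le_opnorm_mult_norm_image[OF assms, of "C *v x"]
    by (simp add: matrix_vector_mul_assoc)
  also have "\<dots> \<le> opnorm B * (opnorm (B ** C) * norm x)"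
    by (intro mult_left_mono opnorm_le opnorm_nonneg)
  finally show "norm (C *v x) \<le> opnorm B * opnorm (B ** C) * norm x"
    by (simp add: mult.assoc)
qed

lemma matrix_inv_SL2:
  fixes B :: "real^2^2"
  assumes "det B = 1"
  shows "B ** matrix_inv B = mat 1" "matrix_inv B ** B = mat 1" "det (matrix_inv B) = 1"
proof -
  have "\<exists>B'. B ** B' = mat 1 \<and> B' ** B = mat 1"
    using assms by (simp add: invertible_det_nz flip: invertible_def)
  then have "B ** matrix_inv B = mat 1 \<and> matrix_inv B ** B = mat 1"
    unfolding matrix_inv_def by (rule someI_ex)
  then show 1: "B ** matrix_inv B = mat 1" and "matrix_inv B ** B = mat 1" by auto
  show "det (matrix_inv B) = 1"
    using arg_cong[OF 1, of det] assms by (simp add: det_mul)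
qed

text \<open>Let \<open>x\<close> be stretched most and let \<open>z\<close> be the preimage of
  \<open>rot90 (B *v x)\<close>. The image of \<open>z\<close> has length \<open>opnorm B\<close>,
  while area preservation makes \<open>z\<close> itself at least \<open>opnorm B\<close> squared
  long.\<close>

lemma ex_most_contracted:
  assumes "det B = 1"
  shows "\<exists>w. norm w = 1 \<and> norm (B *v w) \<le> 1 / opnorm B"
proof -
  have a: "1 \<le> opnorm B" by (rule one_le_opnorm[OF assms])
  obtain x where x: "norm x = 1" "norm (B *v x) = opnorm B" by (rule opnorm_attained)
  define z where "z = matrix_inv B *v rot90 (B *v x)"
  have Bz: "B *v z = rot90 (B *v x)"
    by (simp add: z_def matrix_vector_mul_assoc matrix_inv_SL2 assms)
  have "opnorm B * opnorm B = \<bar>cross2 (B *v x) (B *v z)\<bar>"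
    using x by (simp add: Bz cross2_rot90 dot_square_norm power2_eq_square)
  also have "\<dots> \<le> norm z"
    using abs_cross2_le[of x z] x assms by (simp add: cross2_matrix)
  finally have z: "opnorm B * opnorm B \<le> norm z" .
  then have "z \<noteq> 0" using a by (auto simp: mult_le_0_iff)
  moreover have "norm (B *v (z /\<^sub>R norm z)) \<le> 1 / opnorm B"
    using z a x \<open>z \<noteq> 0\<close> by (simp add: matrix_vector_mult_scaleR Bz field_simps)
  ultimately show ?thesis by (intro exI[of _ "z /\<^sub>R norm z"]) simp
qed

text \<open>Cramer's rule expands a maximally stretched \<open>x\<close> in terms of
  \<open>y\<close> and \<open>w\<close>. The use: two directions with short images under a matrix of
  large norm are nearly parallel.\<close>

lemma opnorm_cross2_le:
  "opnorm B * \<bar>cross2 y w\<bar> \<le> norm w * norm (B *v y) + norm y * norm (B *v w)"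
proof -
  obtain x where x: "norm x = 1" "norm (B *v x) = opnorm B" by (rule opnorm_attained)
  have "opnorm B * \<bar>cross2 y w\<bar> = norm (B *v (cross2 y w *\<^sub>R x))"
    by (simp add: matrix_vector_mult_scaleR x)
  also have "\<dots> = norm (cross2 x w *\<^sub>R (B *v y) + cross2 y x *\<^sub>R (B *v w))"
    by (simp add: cross2_decompose[of y w x] matrix_vector_mult_scaleR matrix_vector_right_distrib)
  also have "\<dots> \<le> \<bar>cross2 x w\<bar> * norm (B *v y) + \<bar>cross2 y x\<bar> * norm (B *v w)"
    using norm_triangle_ineq by (metis norm_scaleR)
  also have "\<dots> \<le> norm w * norm (B *v y) + norm y * norm (B *v w)"
    using abs_cross2_le[of x w] abs_cross2_le[of y x] x
    by (intro add_mono mult_right_mono) auto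
  finally show ?thesis .
qed

section \<open>Cocycle products with exponentially growing norms\<close>

lemma forward_add: "forward A (m + n) j = forward A n (j + int m) ** forward A m j"
  by (induction n) (simp_all add: matrix_mul_assoc add.assoc)

lemma forward_Suc_right: "forward A (Suc n) j = forward A n (j + 1) ** A j"
  using forward_add[of A 1 n j] by simp

locale sl2_growth =
  fixes A :: "int \<Rightarrow> real^2^2" and M c l :: real
  assumes det_A: "det (A j) = 1"
    and opnorm_A: "opnorm (A j) \<le> M"
    and c_pos: "0 < c"
    and l_gt_1: "1 < l"
    and growth: "c * l ^ n \<le> opnorm (forward A n j)"
begin

lemma M_ge_1: "1 \<le> M"
  using one_le_opnorm[OF det_A] opnorm_A order_trans by blast

lemma det_forward: "det (forward A n j) = 1"
  by (induction n) (simp_all add: det_mul det_A)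

abbreviation a :: "int \<Rightarrow> nat \<Rightarrow> real" where
  "a j n \<equiv> opnorm (forward A n j)"

lemma a_ge_1: "1 \<le> a j n"
  by (rule one_le_opnorm[OF det_forward])

lemma a_le_power: "a j n \<le> M ^ n"
proof (induction n)
  case 0
  show ?case by (auto intro: opnorm_leI)
next
  case (Suc n)
  have "a j (Suc n) \<le> opnorm (A (j + int n)) * a j n"
    by (simp add: opnorm_mult_le)
  also have "\<dots> \<le> M * M ^ n"
    using M_ge_1 by (intro mult_mono opnorm_A Suc opnorm_nonneg) auto
  finally show ?case by simp
qed

lemma a_le_Suc: "a j n \<le> M * a j (Suc n)"
proof -
  have "a j n \<le> opnorm (A (j + int n)) * a j (Suc n)"
    using opnorm_factor_le[OF det_A] by simp
  also have "\<dots> \<le> M * a j (Suc n)"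
    by (intro mult_right_mono opnorm_A opnorm_nonneg)
  finally show ?thesis .
qed

lemma a_Suc_le_shift: "a j (Suc n) \<le> M * a (j + 1) n"
proof -
  have "a j (Suc n) \<le> a (j + 1) n * opnorm (A j)"
    by (simp only: forward_Suc_right opnorm_mult_le)
  also have "\<dots> \<le> a (j + 1) n * M"
    by (intro mult_left_mono opnorm_A opnorm_nonneg)
  finally show ?thesis by (simp add: mult.commute)
qed

text \<open>Under the product of length \<open>n + 1\<close> both \<open>v\<close> and
  \<open>w\<close> have images of length at most \<open>M / a j n\<close>, so
  \<open>opnorm_cross2_le\<close> applies. Dividing by \<open>a j (Suc n)\<close>, which is at least
  \<open>a j n / M\<close>, yields the second factor \<open>M\<close>.\<close>

lemma consecutive_contracted_close:
  assumes "norm v = 1" "norm (forward A n j *v v) \<le> 1 / a j n"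
    and "norm w = 1" "norm (forward A (Suc n) j *v w) \<le> 1 / a j (Suc n)"
  shows "\<bar>cross2 v w\<bar> \<le> 2 * M\<^sup>2 / (a j n)\<^sup>2"
proof -
  note pos = a_ge_1[of n j] a_ge_1[of "Suc n" j] M_ge_1
  have inv: "1 / a j (Suc n) \<le> M / a j n"
    using a_le_Suc[of n j] pos by (simp add: field_simps)
  have "norm (forward A (Suc n) j *v v) \<le> opnorm (A (j + int n)) * norm (forward A n j *v v)"
    by (simp add: opnorm_le flip: matrix_vector_mul_assoc)
  also have "\<dots> \<le> M * (1 / a j n)"
    using pos by (intro mult_mono opnorm_A assms) auto
  finally have "a j (Suc n) * \<bar>cross2 v w\<bar> \<le> M / a j n + 1 / a j (Suc n)"
    using opnorm_cross2_le[of "forward A (Suc n) j" v w] assms by simp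
  also have "\<dots> \<le> 2 * M / a j n"
    using inv by simp
  finally have "\<bar>cross2 v w\<bar> \<le> 2 * M / a j n * (1 / a j (Suc n))"
    using pos by (simp add: field_simps)
  also have "\<dots> \<le> 2 * M / a j n * (M / a j n)"
    using pos by (intro mult_left_mono inv) auto
  finally show ?thesis by (simp add: power2_eq_square)
qed

text \<open>For \<open>q > 1\<close> this is the sum over \<open>k\<close> of
  \<open>2 * M\<^sup>2 / q ^ (2 * k)\<close>, the total turning of the most contracted directions
  when the norms grow like \<open>q ^ k\<close>.\<close>

definition D :: "real \<Rightarrow> real" where
  "D q = 2 * M\<^sup>2 / (1 - 1 / q\<^sup>2)"

lemma D_pos: "1 < q \<Longrightarrow> 0 < D q"
  using M_ge_1 by (simp add: D_def power_one_over[symmetric] power_less_one_iff)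

text \<open>The direction is a limit of most contracted ones. It is fixed before \<open>n\<close>,
  \<open>b\<close> and \<open>q\<close> because it is later tested against two lower bounds:
  \<open>b = c * l ^ n\<close> with \<open>q = l\<close>, and \<open>b = a j n\<close> with
  \<open>q = sqrt l\<close> at selected times.\<close>

lemma ex_contracted_direction:
  "\<exists>w. norm w = 1 \<and> (\<forall>n b q. 0 < b \<longrightarrow> 1 < q \<longrightarrow> (\<forall>k. b * q ^ k \<le> a j (n + k)) \<longrightarrow>
     norm (forward A n j *v w) \<le> 1 / a j n + a j n * (D q / b\<^sup>2))"
proof -
  have "\<exists>w. \<forall>n. norm (w n) = 1 \<and> norm (forward A n j *v w n) \<le> 1 / a j n"
    using ex_most_contracted[OF det_forward] by (intro choice) blast
  then obtain w where w: "\<And>n. norm (w n) = 1"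
    and contr: "\<And>n. norm (forward A n j *v w n) \<le> 1 / a j n" by blast
  \<comment> \<open>The vectors \<open>w n\<close> may flip sign, so they need not converge. A
    subsequence suffices, since \<open>w n\<close> will be compared with every later
    \<open>w m\<close>.\<close>
  obtain v r where "v \<in> sphere 0 1" and r: "strict_mono r" and lim: "(w \<circ> r) \<longlonglongrightarrow> v"
    using compact_sphere[of "0::real^2" 1, unfolded compact_def] w by (metis dist_0_norm mem_sphere)
  then have v: "norm v = 1" by simp
  show ?thesis
  proof (intro exI[of _ v] conjI allI impI v)
    fix n b q
    assume b: "(0::real) < b" and q: "(1::real) < q" and ak: "\<forall>k. b * q ^ k \<le> a j (n + k)"
    define p where "p = 1 / q\<^sup>2"
    have p: "0 < p" "p < 1" using q by (simp_all add: p_def one_less_power)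
    have step: "\<bar>cross2 (w (n + k)) (w (Suc (n + k)))\<bar> \<le> 2 * M\<^sup>2 / b\<^sup>2 * p ^ k" for k
    proof -
      have "\<bar>cross2 (w (n + k)) (w (Suc (n + k)))\<bar> \<le> 2 * M\<^sup>2 / (a j (n + k))\<^sup>2"
        by (intro consecutive_contracted_close w contr)
      also have "\<dots> \<le> 2 * M\<^sup>2 / (b * q ^ k)\<^sup>2"
        using b q ak a_ge_1[of "n + k" j]
        by (intro divide_left_mono power_mono mult_pos_pos) auto
      also have "\<dots> = 2 * M\<^sup>2 / b\<^sup>2 * p ^ k"
        by (simp add: p_def power_mult_distrib power_one_over power_mult[symmetric] mult.commute)
      finally show ?thesis .
    qed
    \<comment> \<open>The right-hand side is the partial geometric sum of the bounds in
      \<open>step\<close>, because \<open>2 * M\<^sup>2 = D q * (1 - p)\<close>; in this form the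
      induction closes.\<close>
    have close: "\<bar>cross2 (w n) (w (n + k))\<bar> \<le> D q / b\<^sup>2 * (1 - p ^ k)" for k
    proof (induction k)
      case 0
      show ?case by (simp add: cross2_def)
    next
      case (Suc k)
      have "\<bar>cross2 (w n) (w (n + Suc k))\<bar>
          \<le> \<bar>cross2 (w n) (w (n + k))\<bar> + \<bar>cross2 (w (n + k)) (w (Suc (n + k)))\<bar>"
        using abs_cross2_triangle[OF w w w] by simp
      also have "\<dots> \<le> D q / b\<^sup>2 * (1 - p ^ k) + 2 * M\<^sup>2 / b\<^sup>2 * p ^ k"
        by (intro add_mono Suc step)
      also have "2 * M\<^sup>2 = D q * (1 - p)"
        using p by (simp add: D_def p_def)
      finally show ?case by (simp add: algebra_simps add_divide_distrib diff_divide_distrib)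
    qed
    have close': "\<bar>cross2 (w n) (w m)\<bar> \<le> D q / b\<^sup>2" if "n \<le> m" for m
    proof -
      have "D q / b\<^sup>2 * (1 - p ^ (m - n)) \<le> D q / b\<^sup>2 * 1"
        using D_pos[OF q] p by (intro mult_left_mono) auto
      then show ?thesis using close[of "m - n"] that by simp
    qed
    have "(\<lambda>i. \<bar>cross2 (w n) (w (r i))\<bar>) \<longlonglongrightarrow> \<bar>cross2 (w n) v\<bar>"
      using lim unfolding cross2_def comp_def by (intro tendsto_intros)
    then have lim_close: "\<bar>cross2 (w n) v\<bar> \<le> D q / b\<^sup>2"
    proof (rule LIMSEQ_le_const2)
      show "\<exists>N. \<forall>i\<ge>N. \<bar>cross2 (w n) (w (r i))\<bar> \<le> D q / b\<^sup>2"
        using seq_suble[OF r] close' by (meson order_trans)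
    qed
    \<comment> \<open>Orthonormal expansion of \<open>v\<close>: the component along
      \<open>w n\<close> is contracted to \<open>1 / a j n\<close>, and the other has size at most
      \<open>D q / b\<^sup>2\<close> and is stretched by at most \<open>a j n\<close>.\<close>
    have "v = (v \<bullet> w n) *\<^sub>R w n + cross2 (w n) v *\<^sub>R rot90 (w n)"
      using cross2_decompose[of "w n" "rot90 (w n)" v] w[of n]
      by (simp add: cross2_rot90 dot_square_norm)
    then have "norm (forward A n j *v v) = norm ((v \<bullet> w n) *\<^sub>R (forward A n j *v w n)
        + cross2 (w n) v *\<^sub>R (forward A n j *v rot90 (w n)))"
      by (metis matrix_vector_mult_scaleR matrix_vector_right_distrib)
    also have "\<dots> \<le> \<bar>v \<bullet> w n\<bar> * norm (forward A n j *v w n)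
        + \<bar>cross2 (w n) v\<bar> * norm (forward A n j *v rot90 (w n))"
      using norm_triangle_ineq by (metis norm_scaleR)
    also have "\<dots> \<le> 1 * (1 / a j n) + D q / b\<^sup>2 * a j n"
    proof (intro add_mono mult_mono)
      show "\<bar>v \<bullet> w n\<bar> \<le> 1" using Cauchy_Schwarz_ineq2[of v "w n"] v w by simp
      show "norm (forward A n j *v rot90 (w n)) \<le> a j n"
        using opnorm_le[of "forward A n j" "rot90 (w n)"] w by simp
    qed (use lim_close contr D_pos[OF q] in auto)
    finally show "norm (forward A n j *v v) \<le> 1 / a j n + a j n * (D q / b\<^sup>2)"
      by (simp add: mult.commute)
  qed
qed

section \<open>The stable direction and its invariance\<close>

definition stable_vec :: "int \<Rightarrow> real^2" where
  "stable_vec j = (SOME w. norm w = 1 \<and> (\<forall>n b q. 0 < b \<longrightarrow> 1 < q \<longrightarrow> (\<forall>k. b * q ^ k \<le> a j (n + k)) \<longrightarrow>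
     norm (forward A n j *v w) \<le> 1 / a j n + a j n * (D q / b\<^sup>2)))"

lemma norm_stable_vec: "norm (stable_vec j) = 1"
  using someI_ex[OF ex_contracted_direction[of j]] by (simp add: stable_vec_def)

lemma norm_forward_stable_vec:
  assumes "0 < b" "1 < q" "\<And>k. b * q ^ k \<le> a j (n + k)"
  shows "norm (forward A n j *v stable_vec j) \<le> 1 / a j n + a j n * (D q / b\<^sup>2)"
  using someI_ex[OF ex_contracted_direction[of j]] assms unfolding stable_vec_def by blast

definition K :: real where
  "K = (1 + D l) / c\<^sup>2"

text \<open>This is the case \<open>b = c * l ^ n\<close>, \<open>q = l\<close>, with
  \<open>1 / a j n\<close> absorbed by means of \<open>c * l ^ n \<le> a j n\<close>. It need not
  give decay, since \<open>a j n\<close> may grow faster than \<open>l ^ (2 * n)\<close>, but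
  smallness relative to \<open>a j n\<close> is what pins down the direction.\<close>

lemma norm_forward_stable_vec_le: "norm (forward A n j *v stable_vec j) \<le> K * a j n / (l\<^sup>2) ^ n"
proof -
  have pos: "0 < a j n" using a_ge_1[of n j] by linarith
  have "norm (forward A n j *v stable_vec j) \<le> 1 / a j n + a j n * (D l / (c * l ^ n)\<^sup>2)"
    using c_pos l_gt_1 growth[of "n + _" j]
    by (intro norm_forward_stable_vec) (auto simp: power_add mult.assoc)
  also have "1 / a j n \<le> a j n * (1 / (c * l ^ n)\<^sup>2)"
  proof -
    have "(c * l ^ n)\<^sup>2 \<le> (a j n)\<^sup>2"
      using growth c_pos l_gt_1 by (intro power_mono) auto
    then show ?thesis using c_pos l_gt_1 pos
      by (simp add: divide_simps power2_eq_square)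
  qed
  finally show ?thesis
    by (simp add: K_def power_mult_distrib power_mult[symmetric] mult.commute algebra_simps add_divide_distrib)
qed

lemma K_pos: "0 < K"
  using D_pos[OF l_gt_1] c_pos by (simp add: K_def)

text \<open>Otherwise every vector would be \<open>o(\<parallel>A\<^sub>n\<parallel>)\<close> under \<open>A\<^sub>n\<close>.\<close>

lemma cross2_stable_vec_step: "cross2 (A j *v stable_vec j) (stable_vec (j + 1)) = 0"
proof -
  have bound: "\<bar>cross2 (A j *v stable_vec j) (stable_vec (j + 1))\<bar> \<le> 2 * K * M * (1 / l\<^sup>2) ^ n" for n
  proof -
    let ?B = "forward A n (j + 1)"
    have pos: "0 < a (j + 1) n" using a_ge_1[of n "j + 1"] by linarith
    have "norm (?B *v (A j *v stable_vec j)) = norm (forward A (Suc n) j *v stable_vec j)"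
      by (simp only: forward_Suc_right matrix_vector_mul_assoc)
    also have "\<dots> \<le> K * a j (Suc n) / (l\<^sup>2) ^ Suc n"
      by (rule norm_forward_stable_vec_le)
    \<comment> \<open>Changing the starting point from \<open>j\<close> to \<open>j + 1\<close>
      costs a factor \<open>M\<close>; afterwards both vectors are measured against the norm of the
      same matrix \<open>?B\<close>.\<close>
    also have "\<dots> \<le> K * (M * a (j + 1) n) / (l\<^sup>2) ^ n"
      using K_pos l_gt_1 M_ge_1 pos a_Suc_le_shift[of n j]
      by (intro frac_le mult_left_mono power_increasing mult_nonneg_nonneg) auto
    finally have 1: "norm (?B *v (A j *v stable_vec j)) \<le> K * (M * a (j + 1) n) / (l\<^sup>2) ^ n" .
    have 2: "norm (A j *v stable_vec j) \<le> M"
      using opnorm_le[of "A j" "stable_vec j"] opnorm_A[of j] by (simp add: norm_stable_vec)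
    have "a (j + 1) n * \<bar>cross2 (A j *v stable_vec j) (stable_vec (j + 1))\<bar>
        \<le> norm (?B *v (A j *v stable_vec j)) + norm (A j *v stable_vec j) * norm (?B *v stable_vec (j + 1))"
      using opnorm_cross2_le[of ?B "A j *v stable_vec j" "stable_vec (j + 1)"] by (simp add: norm_stable_vec)
    also have "\<dots> \<le> K * (M * a (j + 1) n) / (l\<^sup>2) ^ n + M * (K * a (j + 1) n / (l\<^sup>2) ^ n)"
      using 1 2 M_ge_1 by (intro add_mono mult_mono norm_forward_stable_vec_le) auto
    also have "\<dots> = a (j + 1) n * (2 * K * M * (1 / l\<^sup>2) ^ n)"
      by (simp add: power_one_over field_simps)
    finally show ?thesis using pos by simp
  qed
  have "(\<lambda>n. 2 * K * M * (1 / l\<^sup>2) ^ n) \<longlonglongrightarrow> 2 * K * M * 0"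
    using l_gt_1 by (intro tendsto_intros LIMSEQ_realpow_zero) (auto simp: one_less_power)
  then have "\<bar>cross2 (A j *v stable_vec j) (stable_vec (j + 1))\<bar> \<le> 2 * K * M * 0"
    by (rule LIMSEQ_le_const) (use bound in blast)
  then show ?thesis by simp
qed

definition stable :: "int \<Rightarrow> (real^2) set" where
  "stable j = span {stable_vec j}"

lemma stable_RP1: "stable j \<in> RP1"
  using norm_stable_vec[of j] by (auto simp: RP1_def stable_def dim_insert)

lemma act_stable: "act (A j) (stable j) = stable (j + 1)"
proof -
  define t where "t = (A j *v stable_vec j) \<bullet> stable_vec (j + 1)"
  have t: "A j *v stable_vec j = t *\<^sub>R stable_vec (j + 1)"
    unfolding t_def by (intro cross2_zero_parallel cross2_stable_vec_step norm_stable_vec)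
  have "A j *v stable_vec j \<noteq> 0"
    using norm_le_opnorm_mult_norm_image[OF det_A[of j], of "stable_vec j"] by (auto simp: norm_stable_vec)
  then have "t \<noteq> 0" using t by auto
  have "act (A j) (stable j) = span {A j *v stable_vec j}"
    using linear_span_image[OF matrix_vector_mul_linear, of "A j" "{stable_vec j}"]
    by (simp add: act_def stable_def)
  also have "\<dots> = stable (j + 1)"
    using span_image_scale[of "{stable_vec (j + 1)}" "\<lambda>_. t"] \<open>t \<noteq> 0\<close> by (simp add: t stable_def)
  finally show ?thesis .
qed

section \<open>Uniform contraction along the stable lines\<close>

lemma forward_stable: "v \<in> stable j \<Longrightarrow> forward A n j *v v \<in> stable (j + int n)"
proof (induction n)
  case (Suc n)
  then have "A (j + int n) *v (forward A n j *v v) \<in> act (A (j + int n)) (stable (j + int n))"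
    by (simp add: act_def)
  then show ?case
    by (simp only: act_stable matrix_vector_mul_assoc forward.simps of_nat_Suc) (simp add: ac_simps)
qed simp

text \<open>Take \<open>n\<close> minimising \<open>a j k / q ^ k\<close> over the window. Beyond
  the window growth gives \<open>a j k / q ^ k \<ge> c * q ^ k\<close>, because
  \<open>l = q\<^sup>2\<close>, and this already exceeds the value at \<open>m\<close>. As
  \<open>a j m \<le> M ^ m\<close> for every \<open>j\<close>, the window does not depend on
  \<open>j\<close>.\<close>

lemma ex_record_time:
  assumes "1 < q" "q\<^sup>2 = l"
  shows "\<exists>N\<ge>m. \<forall>j. \<exists>n\<in>{m..N}. \<forall>k. a j n * q ^ k \<le> a j (n + k)"
proof -
  obtain N0 where "M ^ m / c < q ^ N0" using real_arch_pow[OF assms(1)] by blast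
  then have N0: "M ^ m \<le> c * q ^ N0" using c_pos by (simp add: field_simps)
  define N where "N = max m N0"
  have "\<exists>n\<in>{m..N}. \<forall>k. a j n * q ^ k \<le> a j (n + k)" for j
  proof -
    define f where "f k = a j k / q ^ k" for k
    obtain n where n: "n \<in> {m..N}" and min: "\<And>k. k \<in> {m..N} \<Longrightarrow> f n \<le> f k"
      using ex_is_arg_min_if_finite[of "{m..N}" f]
      by (auto simp: is_arg_min_linorder N_def)
    have "f n \<le> f k" if "m \<le> k" for k
    proof (cases "k \<le> N")
      case False
      have "f n \<le> f m" using n by (intro min) auto
      also have "f m \<le> a j m"
        using assms(1) a_ge_1[of m j]
        by (simp add: f_def field_simps one_le_power mult_left_mono)
      also have "\<dots> \<le> c * q ^ N0" using a_le_power N0 by (rule order_trans)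
      also have "\<dots> \<le> c * q ^ k"
        using c_pos assms(1) False by (intro mult_left_mono power_increasing) (auto simp: N_def)
      also have "\<dots> = c * l ^ k / q ^ k"
        using assms by (simp add: power_mult[symmetric] flip: assms(2)) (simp add: mult_2 power_add)
      also have "\<dots> \<le> f k"
        using assms(1) growth by (simp add: f_def divide_right_mono)
      finally show ?thesis .
    qed (use that min in auto)
    then have "f n \<le> f (n + k)" for k using n by auto
    then have "a j n * q ^ k \<le> a j (n + k)" for k
      using assms(1) by (simp add: f_def field_simps power_add)
    then show ?thesis using n by blast
  qed
  then show ?thesis by (intro exI[of _ N]) (auto simp: N_def)
qed

text \<open>At a record time the lower bound holds with \<open>b = a j n\<close>, so both terms of
  the estimate are of order \<open>1 / a j n\<close>.\<close>

lemma ex_uniform_halving: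
  "\<exists>N\<ge>1. \<forall>j. \<exists>n\<in>{1..N}. \<forall>v\<in>stable j. norm (forward A n j *v v) \<le> norm v / 2"
proof -
  define q where "q = sqrt l"
  have q: "1 < q" "q\<^sup>2 = l" using l_gt_1 by (simp_all add: q_def)
  \<comment> \<open>From time \<open>m0\<close> on, growth forces
    \<open>a j n \<ge> 2 * (1 + D q)\<close>, which turns \<open>(1 + D q) / a j n\<close> into at
    most one half.\<close>
  obtain m0 where m0: "2 * (1 + D q) / c < l ^ m0" using real_arch_pow[OF l_gt_1] by blast
  define m where "m = max 1 m0"
  obtain N where "N \<ge> m" and N: "\<And>j. \<exists>n\<in>{m..N}. \<forall>k. a j n * q ^ k \<le> a j (n + k)"
    using ex_record_time[OF q, of m] by blast
  have "\<exists>n\<in>{1..N}. \<forall>v\<in>stable j. norm (forward A n j *v v) \<le> norm v / 2" for j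
  proof -
    obtain n where n: "n \<in> {m..N}" and low: "\<And>k. a j n * q ^ k \<le> a j (n + k)"
      using N[of j] by blast
    have pos: "0 < a j n" using a_ge_1[of n j] by linarith
    have "2 * (1 + D q) \<le> c * l ^ m0" using m0 c_pos by (simp add: field_simps)
    also have "\<dots> \<le> c * l ^ n"
      using c_pos l_gt_1 n by (intro mult_left_mono power_increasing) (auto simp: m_def)
    also have "\<dots> \<le> a j n" by (rule growth)
    finally have big: "2 * (1 + D q) \<le> a j n" .
    have "norm (forward A n j *v stable_vec j) \<le> 1 / a j n + a j n * (D q / (a j n)\<^sup>2)"
      using pos q(1) low by (rule norm_forward_stable_vec)
    also have "\<dots> = (1 + D q) / a j n"
      using pos by (simp add: field_simps power2_eq_square)
    also have "\<dots> \<le> 1 / 2" using big pos by (simp add: field_simps)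
    finally have half: "norm (forward A n j *v stable_vec j) \<le> 1 / 2" .
    have "norm (forward A n j *v v) \<le> norm v / 2" if "v \<in> stable j" for v
    proof -
      obtain t where "v = t *\<^sub>R stable_vec j" using \<open>v \<in> stable j\<close> unfolding stable_def span_singleton by blast
      then show ?thesis
        using mult_left_mono[OF half, of "\<bar>t\<bar>"] by (simp add: matrix_vector_mult_scaleR norm_stable_vec)
    qed
    then show ?thesis using n by (intro bexI[of _ n]) (auto simp: m_def)
  qed
  then show ?thesis using \<open>N \<ge> m\<close> by (intro exI[of _ N]) (auto simp: m_def)
qed

lemma stable_decay:
  "\<exists>C>0. \<exists>k>1. \<forall>n j. \<forall>v\<in>stable j. norm (forward A n j *v v) \<le> C / k ^ n * norm v"
proof -
  obtain N where N: "N \<ge> 1"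
    and half: "\<And>j. \<exists>n\<in>{1..N}. \<forall>v\<in>stable j. norm (forward A n j *v v) \<le> norm v / 2"
    using ex_uniform_halving by blast
  \<comment> \<open>Since \<open>k ^ m \<le> 2\<close> for \<open>m \<le> N\<close>, halving after
    \<open>m\<close> steps is at least as good as contraction by \<open>k ^ m\<close>. The strong
    induction peels off one such block at a time.\<close>
  define k where "k = root N 2"
  \<comment> \<open>Pays for the fewer than \<open>N\<close> remaining steps, where the norm is at
    most \<open>M ^ N\<close> and \<open>k ^ n \<le> 2\<close>.\<close>
  define C where "C = 2 * M ^ N"
  have k: "1 < k" "k ^ N = 2" using N by (auto simp: k_def)
  have C: "0 < C" using M_ge_1 by (simp add: C_def)
  have k_le: "k ^ n \<le> 2" if "n \<le> N" for n
    using power_increasing[OF that, of k] k by simp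
  have "norm (forward A n j *v v) \<le> C / k ^ n * norm v" if "v \<in> stable j" for n j v
    using that
  proof (induction n arbitrary: j v rule: less_induct)
    case (less n)
    show ?case
    proof (cases "n < N")
      case True
      have "a j n * 1 \<le> M ^ N * (2 / k ^ n)"
        using True M_ge_1 k k_le[of n] a_le_power[of n j] power_increasing[of n N M]
        by (intro mult_mono) auto
      then have "a j n * norm v \<le> C / k ^ n * norm v"
        by (intro mult_right_mono) (auto simp: C_def mult.commute)
      then show ?thesis using opnorm_le order_trans by blast
    next
      case False
      obtain m where m: "m \<in> {1..N}"
        and hv: "norm (forward A m j *v v) \<le> norm v / 2"
        using half[of j] less.prems by blast
      have "norm (forward A n j *v v) = norm (forward A (n - m) (j + int m) *v (forward A m j *v v))"
        using m False forward_add[of A m "n - m" j] by (simp add: matrix_vector_mul_assoc)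
      also have "\<dots> \<le> C / k ^ (n - m) * norm (forward A m j *v v)"
        using m False less.prems by (intro less.IH forward_stable) auto
      also have "\<dots> \<le> C / k ^ (n - m) * (norm v / k ^ m)"
      proof (intro mult_left_mono)
        have "norm v / 2 \<le> norm v / k ^ m"
          using m k k_le[of m] by (intro divide_left_mono) auto
        then show "norm (forward A m j *v v) \<le> norm v / k ^ m" using hv by linarith
      qed (use C k in auto)
      also have "\<dots> = C / k ^ n * norm v"
        using m False power_add[of k "n - m" m] by simp
      finally show ?thesis .
    qed
  qed
  then show ?thesis using C k by blast
qed

end

section \<open>Time reversal and the two implications\<close>

lemma backward_forward:
  assumes "\<And>j. det (A j) = 1"
  shows "backward A n j ** forward A n (j - int n) = mat 1"
proof (induction n)
  case (Suc n)
  let ?i = "j - int (Suc n)"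
  have "backward A (Suc n) j ** forward A (Suc n) ?i
      = matrix_inv (A ?i) ** (backward A n j ** forward A n (?i + 1)) ** A ?i"
    by (simp only: forward_Suc_right backward.simps matrix_mul_assoc)
  also have "?i + 1 = j - int n" by simp
  finally show ?case using Suc assms by (simp add: matrix_inv_SL2)
qed simp

text \<open>Time runs backwards under \<open>i\<close> to \<open>- i\<close>; the extra shift by 1
  arises because the step from \<open>j\<close> back to \<open>j - 1\<close> inverts
  \<open>A (j - 1)\<close>.\<close>

lemma forward_reversed:
  "forward (\<lambda>i. matrix_inv (A (- i - 1))) n (- j) = backward A n j"
  by (induction n) (simp_all add: algebra_simps)

lemma growth_imp_uniformly_hyperbolic:
  assumes "sl2_growth A M c l"
  shows "uniformly_hyperbolic A"
proof -
  interpret F: sl2_growth A M c l by fact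
  define A' where "A' = (\<lambda>i. matrix_inv (A (- i - 1)))"
  have det': "det (A' i) = 1" for i
    by (simp add: A'_def matrix_inv_SL2 F.det_A)
  have det_forward': "det (forward A' n i) = 1" for n i
    by (induction n) (simp_all add: det_mul det')
  interpret B: sl2_growth A' M c l
  proof
    fix n j
    show "det (A' j) = 1" by (rule det')
    have "opnorm (A' j) \<le> opnorm (A (- j - 1))"
      by (intro opnorm_le_opnorm_left_inverse F.det_A)
        (simp add: A'_def matrix_inv_SL2 F.det_A)
    then show "opnorm (A' j) \<le> M" using F.opnorm_A order_trans by blast
    \<comment> \<open>The reversed product inverts a forward product of the same length, so its norm
      is at least as large and the growth constants \<open>c\<close> and \<open>l\<close> carry over
      unchanged.\<close>
    have "forward A' n j ** forward A n (- j - int n) = mat 1"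
      using forward_reversed[of A n "- j"] backward_forward[OF F.det_A, where j = "- j"]
      by (simp add: A'_def)
    then have "F.a (- j - int n) n \<le> opnorm (forward A' n j)"
      by (rule opnorm_le_opnorm_left_inverse[OF det_forward'])
    then show "c * l ^ n \<le> opnorm (forward A' n j)"
      using F.growth order_trans by blast
  qed (simp_all add: F.c_pos F.l_gt_1)
  obtain C1 k1 where 1: "C1 > 0" "k1 > 1"
    and s: "\<And>n j v. v \<in> F.stable j \<Longrightarrow> norm (forward A n j *v v) \<le> C1 / k1 ^ n * norm v"
    using F.stable_decay by blast
  obtain C2 k2 where 2: "C2 > 0" "k2 > 1"
    and u: "\<And>n j v. v \<in> B.stable j \<Longrightarrow> norm (forward A' n j *v v) \<le> C2 / k2 ^ n * norm v"
    using B.stable_decay by blast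
  define C where "C = max C1 C2"
  define k where "k = min k1 k2"
  have Ck: "C > 0" "k > 1" using 1 2 by (auto simp: C_def k_def)
  have C1: "C1 / k1 ^ n \<le> C / k ^ n" and C2: "C2 / k2 ^ n \<le> C / k ^ n" for n
    using 1 2 Ck by (auto intro!: frac_le power_mono simp: C_def k_def)
  have act_u: "act (A j) (B.stable (- j)) = B.stable (- (j + 1))" for j
  proof -
    \<comment> \<open>The reversed cocycle leads from \<open>- (j + 1)\<close> to \<open>- j\<close>
      by the inverse of \<open>A j\<close>; applying \<open>A j\<close> to both sides gives forward
      invariance.\<close>
    have "B.stable (- j) = act (A' (- (j + 1))) (B.stable (- (j + 1)))"
      by (simp add: B.act_stable)
    then show ?thesis
      by (simp add: act_def image_image matrix_vector_mul_assoc A'_def matrix_inv_SL2 F.det_A)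
  qed
  have bound_u: "norm (iterate A (- n) j *v v) \<le> C * k powi (- n)"
    if "n \<ge> 1" "v \<in> B.stable (- j)" "norm v = 1" for n j v
  proof -
    have "iterate A (- n) j = forward A' (nat n) (- j)"
      using that by (simp add: iterate_def A'_def forward_reversed)
    then have "norm (iterate A (- n) j *v v) \<le> C / k ^ nat n"
      using u[OF that(2), of "nat n"] that C2 order_trans by fastforce
    then show ?thesis
      using that by (simp add: power_int_def field_simps)
  qed
  have bound_s: "norm (iterate A n j *v v) \<le> C * k powi (- n)"
    if "n \<ge> 1" "v \<in> F.stable j" "norm v = 1" for n j v
  proof -
    have "norm (iterate A n j *v v) \<le> C / k ^ nat n"
      using s[OF that(2), of "nat n"] that C1[of "nat n"] by (simp add: iterate_def)
    then show ?thesis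
      using that by (simp add: power_int_def field_simps)
  qed
  show ?thesis
    unfolding uniformly_hyperbolic_def
    using B.stable_RP1 F.stable_RP1 act_u F.act_stable bound_u bound_s Ck
    by (intro exI[of _ "\<lambda>j. B.stable (- j)"] exI[of _ "F.stable"] conjI exI[of _ C] exI[of _ k]) auto
qed

lemma uniformly_hyperbolic_imp_growth:
  assumes det: "\<And>j. det (A j) = 1" and "uniformly_hyperbolic A"
  shows "\<exists>c>0. \<exists>l>1. \<forall>n::int. n \<ge> 1 \<longrightarrow> (\<forall>j. opnorm (iterate A n j) \<ge> c * l powi n)"
proof -
  obtain u s C l where lines: "\<forall>j. u j \<in> RP1 \<and> s j \<in> RP1" and C: "C > 0" "l > 1"
    and decay: "\<forall>n::int. n \<ge> 1 \<longrightarrow> (\<forall>j v w.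
        v \<in> u j \<and> norm v = 1 \<and> w \<in> s j \<and> norm w = 1 \<longrightarrow>
          norm (iterate A (- n) j *v v) \<le> C * l powi (- n) \<and>
          norm (iterate A n j *v w) \<le> C * l powi (- n))"
    using assms(2) unfolding uniformly_hyperbolic_def by blast
  have unit: "\<exists>v\<in>L. norm v = 1" if "L \<in> RP1" for L :: "(real^2) set"
  proof -
    have "\<not> L \<subseteq> {0}" using that by (auto simp: RP1_def simp flip: dim_eq_0)
    then obtain x where "x \<in> L" "x \<noteq> 0" by blast
    then show ?thesis
      using that by (intro bexI[of _ "x /\<^sub>R norm x"]) (auto simp: RP1_def subspace_scale)
  qed
  have "1 / C * l powi n \<le> opnorm (iterate A n j)" if n: "n \<ge> 1" for n j
  proof -
    \<comment> \<open>The unit vector is taken on the unstable line at time \<open>j + n\<close>: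
      pulled back to time \<open>j\<close> it has length at most \<open>C * l powi (- n)\<close>,
      and the forward product restores length 1.\<close>
    obtain v where v: "v \<in> u (j + n)" "norm v = 1" using lines unit by blast
    \<comment> \<open>The decay condition speaks of a pair of unit vectors, so one on the stable
      line is supplied to instantiate it.\<close>
    obtain w where "w \<in> s (j + n)" "norm w = 1" using lines unit by blast
    then have "norm (iterate A (- n) (j + n) *v v) \<le> C * l powi (- n)"
      using decay n v by blast
    moreover have "iterate A (- n) (j + n) = backward A (nat n) (j + n)"
      using n by (simp add: iterate_def)
    ultimately have small: "norm (backward A (nat n) (j + n) *v v) \<le> C * l powi (- n)" by simp
    have "backward A (nat n) (j + n) ** forward A (nat n) j = mat 1"
      using backward_forward[OF det, where n = "nat n" and j = "j + n"] n by simp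
    then have "forward A (nat n) j ** backward A (nat n) (j + n) = mat 1"
      by (simp add: matrix_left_right_inverse)
    then have "v = iterate A n j *v (backward A (nat n) (j + n) *v v)"
      using n by (simp add: iterate_def matrix_vector_mul_assoc)
    then have "1 \<le> opnorm (iterate A n j) * norm (backward A (nat n) (j + n) *v v)"
      using opnorm_le v(2) by metis
    also have "\<dots> \<le> opnorm (iterate A n j) * (C * l powi (- n))"
      by (intro mult_left_mono small opnorm_nonneg)
    finally show ?thesis
      using C by (simp add: power_int_minus field_simps)
  qed
  then show ?thesis using C by (intro exI[of _ "1 / C"] exI[of _ l] conjI) auto
qed

theorem theorem1:
  fixes A :: "int \<Rightarrow> real^2^2" and M :: real
  assumes "\<And>j. A j \<in> SL2"
    and "M > 0"
    and "\<And>j. opnorm (A j) \<le> M"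
  shows "uniformly_hyperbolic A \<longleftrightarrow>
    (\<exists>c>0. \<exists>l>1. \<forall>n::int. n \<ge> 1 \<longrightarrow> (\<forall>j. opnorm (iterate A n j) \<ge> c * l powi n))"
    (is "_ \<longleftrightarrow> ?growth")
proof
  have det: "det (A j) = 1" for j using assms(1) by (simp add: SL2_def)
  show ?growth if "uniformly_hyperbolic A"
    using det that by (rule uniformly_hyperbolic_imp_growth)
  assume ?growth
  then obtain c l where c: "c > 0" and l: "l > 1"
    and grow: "\<And>n j. n \<ge> 1 \<Longrightarrow> c * l powi n \<le> opnorm (iterate A n j)" by blast
  \<comment> \<open>The locale also asks for the bound at \<open>n = 0\<close>, where the product is
    the identity; hence the constant is capped at 1.\<close>
  have "sl2_growth A M (min c 1) l"
  proof
    fix n j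
    show "min c 1 * l ^ n \<le> opnorm (forward A n j)"
    proof (cases "n = 0")
      case True
      then show ?thesis using one_le_opnorm[of "mat 1"] by simp
    next
      case False
      then have "c * l ^ n \<le> opnorm (forward A n j)"
        using grow[of "int n" j] by (simp add: iterate_def)
      moreover have "min c 1 * l ^ n \<le> c * l ^ n"
        using l by (intro mult_right_mono) auto
      ultimately show ?thesis by linarith
    qed
  qed (use det assms(3) c l in auto)
  then show "uniformly_hyperbolic A" by (rule growth_imp_uniformly_hyperbolic)
qed

end
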